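(* Let $E$ be any subset of the positive integers $\mathbb{N}^*=\{1,2,3,\dots\}$, and let $C(E)$ be the set of all compositions (including the empty composition) all of whose parts belong to $E$. Then, in the algebra of noncommutative formal power series $\mathbb{Q}\langle\langle A\rangle\rangle$ over a totally ordered alphabet $A$, \[ \left( \sum_{I\in C(E)} (-1)^{l(I)}\, \mathbf{G}_{\omega(I)} \right)^{-1} \;=\; \sum_{K\in C(E)} \mathbf{S}^{\mathrm{diam}(K)} . \]
   Context: Permutations $\sigma\in\mathfrak{S}_n$ are written as words $\sigma(1)\sigma(2)\cdots\sigma(n)$, and products are composition of maps: $(\sigma\tau)(i)=\sigma(\tau(i))$. The length $\ell(\sigma)$ is the number of inversions. The empty permutation (of $\mathfrak{S}_0$) corresponds to the empty composition. Standardization: for a word $w$ over a totally ordered alphabet $A$, $\mathrm{Std}(w)$ is the permutation obtained by scanning $w$ from left to right and labelling $1,2,\dots$ the occurrences of its smallest letter, then continuing the numbering with the occurrences of the next smallest letter, and so on (e.g. $\mathrm{Std}(bbacab)=341625$). For $\sigma\in\mathfrak{S}_n$ define the noncommutative polynomial $\mathbf{G}_\sigma=\sum_{w\in A^*,\ \mathrm{Std}(w)=\sigma} w$ (so $\mathbf{G}$ of the empty permutation is $1$). These span a subalgebra of $\mathbb{Q}\langle A\rangle$ (the algebra of free quasi-symmetric functions); infinite sums are taken in the completion $\mathbb{Q}\langle\langle A\rangle\rangle$. Left weak order on $\mathfrak{S}_n$: $\tau\le\sigma$ iff there is $u\in\mathfrak{S}_n$ with $\sigma=u\tau$ and $\ell(\sigma)=\ell(u)+\ell(\tau)$.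 Define $\mathbf{S}^\sigma=\sum_{\tau\in\mathfrak{S}_n,\ \tau\le\sigma}\mathbf{G}_\tau$. Descent compositions: the descent set of $\sigma\in\mathfrak{S}_n$ is $\{i:\sigma(i)>\sigma(i+1)\}$; if it is $\{d_1<\dots<d_k\}$, the descent composition of $\sigma$ is $(d_1-d_0,d_2-d_1,\dots,d_{k+1}-d_k)$ with $d_0=0$, $d_{k+1}=n$. For a composition $I$ of $n$, $l(I)$ is its number of parts, and the set of permutations with descent composition $I$ has a unique element of minimal length $\alpha(I)$ and a unique element of maximal length $\omega(I)$. The mirror image of $I=(i_1,\dots,i_r)$ is $\overline{I}=(i_r,\dots,i_1)$. The diameter is $\mathrm{diam}(I)=\alpha(I)\,\omega(I)^{-1}=\alpha(I)\,\omega(\overline{I})$. *)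

theory Defs
  imports Complex_Main "HOL-Algebra.Ring" "HOL-Combinatorics.Permutations"
begin

section \<open>Permutations of \<open>{1..n}\<close>\<close>

text \<open>
  An element of the symmetric group of degree \<open>n\<close> is a function \<open>\<sigma>\<close> with
  \<open>\<sigma> permutes {1..n}\<close>. Such a function does not determine \<open>n\<close> (the identity permutes
  every \<open>{1..n}\<close>), so \<open>n\<close> is passed explicitly wherever it matters.
\<close>

definition perm_length :: "nat \<Rightarrow> (nat \<Rightarrow> nat) \<Rightarrow> nat" where
  "perm_length n \<sigma> = card {(i, j). i \<in> {1..n} \<and> j \<in> {1..n} \<and> i < j \<and> \<sigma> i > \<sigma> j}"

definition left_weak_le :: "nat \<Rightarrow> (nat \<Rightarrow> nat) \<Rightarrow> (nat \<Rightarrow> nat) \<Rightarrow> bool" where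
  "left_weak_le n \<tau> \<sigma> \<longleftrightarrow>
     (\<exists>u. u permutes {1..n} \<and> \<sigma> = u \<circ> \<tau> \<and>
          perm_length n \<sigma> = perm_length n u + perm_length n \<tau>)"

definition descent_set :: "nat \<Rightarrow> (nat \<Rightarrow> nat) \<Rightarrow> nat set" where
  "descent_set n \<sigma> = {i \<in> {1..<n}. \<sigma> i > \<sigma> (Suc i)}"

text \<open>The empty permutation has the empty composition, not the list \<open>[0]\<close>.\<close>

definition descent_composition :: "nat \<Rightarrow> (nat \<Rightarrow> nat) \<Rightarrow> nat list" where
  "descent_composition n \<sigma> =
     (let ds = sorted_list_of_set (descent_set n \<sigma>)
      in if n = 0 then [] else map2 (-) (ds @ [n]) (0 # ds))"

definition descent_class :: "nat list \<Rightarrow> (nat \<Rightarrow> nat) set" where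
  "descent_class I =
     {\<sigma>. \<sigma> permutes {1..sum_list I} \<and> descent_composition (sum_list I) \<sigma> = I}"

definition alpha_perm :: "nat list \<Rightarrow> nat \<Rightarrow> nat" where
  "alpha_perm I = (THE \<sigma>. is_arg_min (perm_length (sum_list I)) (\<lambda>\<tau>. \<tau> \<in> descent_class I) \<sigma>)"

definition omega_perm :: "nat list \<Rightarrow> nat \<Rightarrow> nat" where
  "omega_perm I = (THE \<sigma>. is_arg_max (perm_length (sum_list I)) (\<lambda>\<tau>. \<tau> \<in> descent_class I) \<sigma>)"

text \<open>\<open>inv_into UNIV\<close> is the inverse function; the symbol \<open>inv\<close> is taken by HOL-Algebra.\<close>

definition diam :: "nat list \<Rightarrow> nat \<Rightarrow> nat" where
  "diam I = alpha_perm I \<circ> inv_into UNIV (omega_perm I)"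


section \<open>Standardization\<close>

text \<open>
  The label of position \<open>i\<close> (counted from 1) is the number of positions that are labelled no later
  than \<open>i\<close>: those carrying a smaller letter, and those carrying the same letter weakly to the left
  of \<open>i\<close>.
\<close>

definition Std :: "'a::linorder list \<Rightarrow> nat \<Rightarrow> nat" where
  "Std w i =
     (if i \<in> {1..length w}
      then card {j \<in> {1..length w}. w ! (j - 1) < w ! (i - 1) \<or> (w ! (j - 1) = w ! (i - 1) \<and> j \<le> i)}
      else i)"

lemma Std_example: "map (Std [2, 2, 1, 3, 1, 2 :: nat]) [1..<7] = [3, 4, 1, 6, 2, 5]"
proof -
  have "{j \<in> {1..6}. P j} = set (filter P [1..<7])" for P
    by auto
  then show ?thesis
    by (simp add: Std_def upt_rec numeral_eq_Suc)
qed

lemma Std_permutes: "Std w permutes {1..length w}"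
proof -
  define lt where "lt = (\<lambda>j i. w ! (j - 1) < w ! (i - 1) \<or> (w ! (j - 1) = w ! (i - 1) \<and> j \<le> i))"
  define A where "A = (\<lambda>i. {j \<in> {1..length w}. lt j i})"
  have eq: "Std w i = card (A i)" if "i \<in> {1..length w}" for i
    using that by (simp add: Std_def A_def lt_def)
  have fin: "finite (A i)" for i
    by (simp add: A_def)
  have less: "card (A i) < card (A j)"
    if "lt i j" "i \<noteq> j" "i \<in> {1..length w}" "j \<in> {1..length w}" for i j
  proof (rule psubset_card_mono[OF fin])
    have "A i \<subseteq> A j" "j \<in> A j" "j \<notin> A i"
      using that by (auto simp: A_def lt_def)
    then show "A i \<subset> A j" by blast
  qed
  have "inj_on (Std w) {1..length w}"
  proof (rule inj_onI)
    fix i j assume ij: "i \<in> {1..length w}" "j \<in> {1..length w}" "Std w i = Std w j"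
    have "lt i j \<or> lt j i"
      by (auto simp: lt_def)
    then show "i = j"
      using less[of i j] less[of j i] eq ij by fastforce
  qed
  moreover have "Std w ` {1..length w} \<subseteq> {1..length w}"
  proof
    fix k assume "k \<in> Std w ` {1..length w}"
    then obtain i where i: "i \<in> {1..length w}" "k = card (A i)"
      using eq by auto
    have "i \<in> A i" "A i \<subseteq> {1..length w}"
      using i by (auto simp: A_def lt_def)
    then have "0 < card (A i)" "card (A i) \<le> length w"
      using fin card_gt_0_iff card_mono[of "{1..length w}" "A i"] by auto
    then show "k \<in> {1..length w}"
      using i by simp
  qed
  ultimately have "bij_betw (Std w) {1..length w} {1..length w}"
    by (simp add: bij_betw_def endo_inj_surj)
  then show ?thesis
    by (rule bij_imp_permutes) (auto simp: Std_def)
qed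


section \<open>Noncommutative formal power series\<close>

text \<open>
  A series over the alphabet \<open>'a\<close> is the function sending a word to its coefficient. Multiplication
  sums over all factorizations \<open>w = take k w @ drop k w\<close>.
\<close>

definition NCPS :: "('a list \<Rightarrow> rat) ring" where
  "NCPS =
     \<lparr>carrier = UNIV,
      monoid.mult = (\<lambda>f g w. \<Sum>k\<le>length w. f (take k w) * g (drop k w)),
      one = (\<lambda>w. if w = [] then 1 else 0),
      zero = (\<lambda>w. 0),
      add = (\<lambda>f g w. f w + g w)\<rparr>"

lemma ring_NCPS: "ring (NCPS :: ('a list \<Rightarrow> rat) ring)"
proof (rule ringI)
  show "abelian_group (NCPS :: ('a list \<Rightarrow> rat) ring)"
  proof (rule abelian_groupI)
    fix f :: "'a list \<Rightarrow> rat"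
    show "\<exists>g\<in>carrier NCPS. g \<oplus>\<^bsub>NCPS\<^esub> f = \<zero>\<^bsub>NCPS\<^esub>"
      by (rule bexI[of _ "\<lambda>w. - f w"]) (simp_all add: NCPS_def)
  qed (auto simp: NCPS_def add_ac)
next
  show "Group.monoid (NCPS :: ('a list \<Rightarrow> rat) ring)"
  proof (rule monoidI)
    fix f g h :: "'a list \<Rightarrow> rat"
    show "f \<otimes>\<^bsub>NCPS\<^esub> g \<otimes>\<^bsub>NCPS\<^esub> h = f \<otimes>\<^bsub>NCPS\<^esub> (g \<otimes>\<^bsub>NCPS\<^esub> h)"
    proof
      fix w :: "'a list"
      let ?n = "length w"
      let ?F = "\<lambda>j i. f (take j w) * g (take i (drop j w)) * h (drop (i + j) w)"
      let ?H = "\<lambda>k j. f (take j w) * g (take (k - j) (drop j w)) * h (drop k w)"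
      have "(f \<otimes>\<^bsub>NCPS\<^esub> g \<otimes>\<^bsub>NCPS\<^esub> h) w = (\<Sum>k\<le>?n. \<Sum>j\<le>k. ?H k j)"
        by (auto simp: NCPS_def sum_distrib_right drop_take min_def intro!: sum.cong)
      also have "\<dots> = (\<Sum>(k, j)\<in>Sigma {..?n} (\<lambda>k. {..k}). ?H k j)"
        by (simp add: sum.Sigma)
      also have "\<dots> = (\<Sum>(j, i)\<in>Sigma {..?n} (\<lambda>j. {..?n - j}). ?F j i)"
        by (rule sum.reindex_bij_witness
            [where i = "\<lambda>(j, i). (i + j, j)" and j = "\<lambda>(k, j). (j, k - j)"]) auto
      also have "\<dots> = (f \<otimes>\<^bsub>NCPS\<^esub> (g \<otimes>\<^bsub>NCPS\<^esub> h)) w"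
        by (simp add: NCPS_def sum_distrib_left sum.Sigma[symmetric] mult.assoc)
      finally show "(f \<otimes>\<^bsub>NCPS\<^esub> g \<otimes>\<^bsub>NCPS\<^esub> h) w = (f \<otimes>\<^bsub>NCPS\<^esub> (g \<otimes>\<^bsub>NCPS\<^esub> h)) w" .
    qed
  next
    fix f :: "'a list \<Rightarrow> rat"
    have "(\<Sum>k\<le>length w. (if take k w = [] then 1 else 0) * f (drop k w))
            = (\<Sum>k\<le>length w. if k = 0 then f w else 0)" for w
      by (rule sum.cong) auto
    then show "\<one>\<^bsub>NCPS\<^esub> \<otimes>\<^bsub>NCPS\<^esub> f = f"
      by (simp add: NCPS_def)
    have "(\<Sum>k\<le>length w. f (take k w) * (if drop k w = [] then 1 else 0))
            = (\<Sum>k\<le>length w. if k = length w then f w else 0)" for w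
      by (rule sum.cong) auto
    then show "f \<otimes>\<^bsub>NCPS\<^esub> \<one>\<^bsub>NCPS\<^esub> = f"
      by (simp add: NCPS_def)
  qed (simp_all add: NCPS_def)
qed (simp_all add: NCPS_def sum.distrib distrib_left distrib_right)

text \<open>
  Sum of a family of series, taken coefficientwise. It is meaningful for families in which every
  word has a nonzero coefficient in only finitely many members; see \<open>finite_support_G\<close> and
  \<open>finite_support_S\<close> below.
\<close>

definition series_sum :: "'i set \<Rightarrow> ('i \<Rightarrow> 'a list \<Rightarrow> rat) \<Rightarrow> 'a list \<Rightarrow> rat" where
  "series_sum C F w = (\<Sum>I | I \<in> C \<and> F I w \<noteq> 0. F I w)"

definition G_series :: "nat \<Rightarrow> (nat \<Rightarrow> nat) \<Rightarrow> 'a::linorder list \<Rightarrow> rat" where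
  "G_series n \<sigma> w = (if length w = n \<and> Std w = \<sigma> then 1 else 0)"

definition S_series :: "nat \<Rightarrow> (nat \<Rightarrow> nat) \<Rightarrow> 'a::linorder list \<Rightarrow> rat" where
  "S_series n \<sigma> w = (\<Sum>\<tau> | \<tau> permutes {1..n} \<and> left_weak_le n \<tau> \<sigma>. G_series n \<tau> w)"

lemma finite_compositions:
  fixes E :: "nat set"
  assumes "E \<subseteq> {1..}"
  shows "finite {I \<in> lists E. sum_list I = n}"
proof (rule finite_subset)
  have "length I \<le> sum_list I" if "I \<in> lists E" for I :: "nat list"
    using that assms by (induction I) auto
  then show "{I \<in> lists E. sum_list I = n} \<subseteq> {I. set I \<subseteq> {..n} \<and> length I \<le> n}"
    using member_le_sum_list by fastforce
qed (simp add: finite_lists_length_le)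

lemma finite_support_G:
  fixes E :: "nat set"
  assumes "E \<subseteq> {1..}"
  shows "finite {I \<in> lists E. c I * G_series (sum_list I) (p I) w \<noteq> 0}"
  by (rule finite_subset[OF _ finite_compositions[OF assms, of "length w"]])
     (auto simp: G_series_def split: if_splits)

lemma finite_support_S:
  fixes E :: "nat set"
  assumes "E \<subseteq> {1..}"
  shows "finite {I \<in> lists E. S_series (sum_list I) (p I) w \<noteq> 0}"
proof (rule finite_subset[OF _ finite_compositions[OF assms, of "length w"]])
  have "S_series n \<sigma> w = 0" if "n \<noteq> length w" for n \<sigma>
    using that by (simp add: S_series_def G_series_def)
  then show "{I \<in> lists E. S_series (sum_list I) (p I) w \<noteq> 0}
               \<subseteq> {I \<in> lists E. sum_list I = length w}"
    by force
qed

end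

theory Submission
  imports Defs
begin

text \<open>
  A word has standardization \<open>\<omega>(I)\<close> iff, cut into blocks of lengths \<open>I\<close>, it consists of weakly
  increasing blocks \<open>u\<^sub>1 \<dots> u\<^sub>r\<close> in which the first letter of each block is larger than the
  last letter of the next one. On the other side, \<open>\<tau> \<le> diam K\<close> iff \<open>\<tau> \<omega>(K)\<close> has descent
  composition \<open>K\<close>, which means that \<open>S\<close> at \<open>diam K\<close> collects the words made of weakly increasing
  blocks, of lengths the mirror image of \<open>K\<close>, in which no first letter of a block is larger than the last
  letter of the next one. So the two series enumerate the lists of blocks all of whose adjacent pairs lie
  in a relation \<open>R\<close>, with sign, respectively in its complement. In their product every list of blocks
  is cut in two with adjacent pairs in \<open>R\<close> before the cut and in the complement of \<open>R\<close> after it;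
  a nonempty list has either no such cut point or two adjacent ones of opposite signs.
\<close>

section \<open>Inversion sets and the left weak order\<close>

definition position_pairs :: "nat \<Rightarrow> (nat \<times> nat) set" where
  "position_pairs n = {(i, j). i \<in> {1..n} \<and> j \<in> {1..n} \<and> i < j}"

definition inversions :: "nat \<Rightarrow> (nat \<Rightarrow> nat) \<Rightarrow> (nat \<times> nat) set" where
  "inversions n \<sigma> = {(i, j) \<in> position_pairs n. \<sigma> i > \<sigma> j}"

lemma perm_length_eq_card_inversions: "perm_length n \<sigma> = card (inversions n \<sigma>)"
  unfolding perm_length_def inversions_def position_pairs_def by (rule arg_cong[of _ _ card]) auto

lemma finite_position_pairs: "finite (position_pairs n)"
  by (rule finite_subset[of _ "{1..n} \<times> {1..n}"]) (auto simp: position_pairs_def)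

lemma inversions_subset: "inversions n \<sigma> \<subseteq> position_pairs n"
  by (auto simp: inversions_def)

lemma finite_inversions: "finite (inversions n \<sigma>)"
  using finite_subset[OF inversions_subset finite_position_pairs] .

text \<open>The value at a position is its rank among all values, so a permutation can be recovered
  from comparisons of its values alone.\<close>

lemma permutes_eq_card_le:
  fixes \<sigma> :: "nat \<Rightarrow> nat"
  assumes "\<sigma> permutes {1..n}" "i \<in> {1..n}"
  shows "\<sigma> i = card {j \<in> {1..n}. \<sigma> j \<le> \<sigma> i}"
proof -
  have "\<sigma> ` {j \<in> {1..n}. \<sigma> j \<le> \<sigma> i} = {k \<in> \<sigma> ` {1..n}. k \<le> \<sigma> i}"
    by auto
  also have "\<dots> = {1..\<sigma> i}"
    using assms permutes_image[OF assms(1)] permutes_in_image[OF assms(1), of i] by auto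
  finally have "card {1..\<sigma> i} = card {j \<in> {1..n}. \<sigma> j \<le> \<sigma> i}"
    using card_image[OF inj_on_subset[OF permutes_inj[OF assms(1)] subset_UNIV]] by metis
  then show ?thesis by simp
qed

text \<open>The inversion set fixes every comparison between two values, hence the rank of each
  value, which is the value itself.\<close>

lemma inversions_inject:
  assumes \<sigma>: "\<sigma> permutes {1..n}" and \<tau>: "\<tau> permutes {1..n}"
    and eq: "inversions n \<sigma> = inversions n \<tau>"
  shows "\<sigma> = \<tau>"
proof
  have mem: "\<sigma> j < \<sigma> i \<longleftrightarrow> \<tau> j < \<tau> i"
    if "i \<in> {1..n}" "j \<in> {1..n}" "i < j" for i j
  proof -
    have "(i, j) \<in> inversions n \<sigma> \<longleftrightarrow> (i, j) \<in> inversions n \<tau>"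
      by (simp only: eq)
    then show ?thesis
      using that by (simp add: inversions_def position_pairs_def)
  qed
  fix i
  show "\<sigma> i = \<tau> i"
  proof (cases "i \<in> {1..n}")
    case True
    have "\<sigma> j \<le> \<sigma> i \<longleftrightarrow> \<tau> j \<le> \<tau> i" if j: "j \<in> {1..n}" for j
    proof (cases i j rule: linorder_cases)
      case less
      then have "\<sigma> j < \<sigma> i \<longleftrightarrow> \<tau> j < \<tau> i"
        using mem[of i j] True j by simp
      then show ?thesis
        using less permutes_inj[OF \<sigma>] permutes_inj[OF \<tau>] by (metis injD order_less_le)
    next
      case greater
      then have "\<sigma> i < \<sigma> j \<longleftrightarrow> \<tau> i < \<tau> j"
        using mem[of j i] True j by simp
      then show ?thesis by (simp add: not_less[symmetric])
    qed simp
    then have "{j \<in> {1..n}. \<sigma> j \<le> \<sigma> i} = {j \<in> {1..n}. \<tau> j \<le> \<tau> i}" by auto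
    then show ?thesis
      using permutes_eq_card_le[OF \<sigma> True] permutes_eq_card_le[OF \<tau> True] by simp
  next
    case False
    then show ?thesis using \<sigma> \<tau> by (metis permutes_not_in)
  qed
qed

section \<open>Left weak order as inclusion of inversion sets\<close>

definition image_pair :: "(nat \<Rightarrow> nat) \<Rightarrow> nat \<times> nat \<Rightarrow> nat \<times> nat" where
  "image_pair \<tau> = (\<lambda>(i, j). (min (\<tau> i) (\<tau> j), max (\<tau> i) (\<tau> j)))"

lemma inj_on_image_pair:
  assumes "inj \<tau>"
  shows "inj_on (image_pair \<tau>) (position_pairs n)"
proof (rule inj_onI, clarify)
  fix i j k l
  assume less: "(i, j) \<in> position_pairs n" "(k, l) \<in> position_pairs n"
    and "image_pair \<tau> (i, j) = image_pair \<tau> (k, l)"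
  then have "min (\<tau> i) (\<tau> j) = min (\<tau> k) (\<tau> l)" "max (\<tau> i) (\<tau> j) = max (\<tau> k) (\<tau> l)"
    by (simp_all add: image_pair_def)
  then have "\<tau> i = \<tau> k \<and> \<tau> j = \<tau> l \<or> \<tau> i = \<tau> l \<and> \<tau> j = \<tau> k"
    by linarith
  then have "i = k \<and> j = l \<or> i = l \<and> j = k"
    using assms by (simp add: inj_eq)
  then show "i = k \<and> j = l"
    using less by (auto simp: position_pairs_def)
qed

lemma inj_on_image_subset_iff:
  assumes "inj_on f C" "A \<subseteq> C" "B \<subseteq> C"
  shows "f ` A \<subseteq> f ` B \<longleftrightarrow> A \<subseteq> B"
proof
  assume "f ` A \<subseteq> f ` B"
  then show "A \<subseteq> B"
    using inj_on_image_mem_iff[OF assms(1) _ assms(3)] assms(2) by blast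
qed (rule image_mono)

text \<open>\<open>image_pair \<tau>\<close> turns two positions into the two values there, in
  increasing order, that is, into two positions of \<open>u\<close>. These are inverted by
  \<open>u\<close> exactly when \<open>\<tau>\<close> and \<open>u \<circ> \<tau>\<close> order the
  original positions differently.\<close>

lemma inversions_eq_image:
  assumes \<tau>: "\<tau> permutes {1..n}" and u: "inj u"
  shows "inversions n u =
    image_pair \<tau> ` sym_diff (inversions n \<tau>) (inversions n (u \<circ> \<tau>))" (is "_ = _ ` ?D")
proof -
  have inj: "\<tau> i = \<tau> j \<longleftrightarrow> i = j" "u i = u j \<longleftrightarrow> i = j" for i j
    using u permutes_inj[OF \<tau>] by (auto dest: injD)
  have in_range: "\<tau> i \<in> {1..n} \<longleftrightarrow> i \<in> {1..n}" for i
    using permutes_in_image[OF \<tau>] .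
  have mem: "image_pair \<tau> (i, j) \<in> inversions n u \<longleftrightarrow> (i, j) \<in> ?D"
    if "(i, j) \<in> position_pairs n" for i j
  proof -
    have "\<tau> i \<noteq> \<tau> j" "u (\<tau> i) \<noteq> u (\<tau> j)" "\<tau> i \<in> {1..n}" "\<tau> j \<in> {1..n}"
      using that inj in_range by (auto simp: position_pairs_def)
    then show ?thesis
      using that by (auto simp: image_pair_def inversions_def position_pairs_def min_def max_def)
  qed
  show ?thesis
  proof
    show "image_pair \<tau> ` ?D \<subseteq> inversions n u"
    proof (rule image_subsetI)
      fix x assume x: "x \<in> ?D"
      then have "x \<in> position_pairs n" using inversions_subset by blast
      then show "image_pair \<tau> x \<in> inversions n u"
        using mem x by (cases x) blast
    qed
    show "inversions n u \<subseteq> image_pair \<tau> ` ?D"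
    proof clarify
      fix a b assume ab: "(a, b) \<in> inversions n u"
      then have "a \<in> \<tau> ` {1..n}" "b \<in> \<tau> ` {1..n}"
        unfolding permutes_image[OF \<tau>] by (auto simp: inversions_def position_pairs_def)
      then obtain i j where ij: "i \<in> {1..n}" "j \<in> {1..n}" "a = \<tau> i" "b = \<tau> j"
        by auto
      have "a < b" using ab by (auto simp: inversions_def position_pairs_def)
      then have "(a, b) = image_pair \<tau> (min i j, max i j)" "i \<noteq> j"
        using ij by (auto simp: image_pair_def min_def max_def)
      moreover have "(min i j, max i j) \<in> position_pairs n"
        using ij \<open>i \<noteq> j\<close> by (auto simp: position_pairs_def min_def max_def)
      ultimately show "(a, b) \<in> image_pair \<tau> ` ?D"
        using mem ab by (metis imageI)
    qed
  qed
qed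

text \<open>The only candidate for \<open>u\<close> is \<open>\<sigma>\<close> composed with the
  inverse of \<open>\<tau>\<close>. Its length is the size of the symmetric difference of the two
  inversion sets, so lengths add up iff no inversion of \<open>\<tau>\<close> is lost.\<close>

lemma left_weak_le_iff_inversions:
  assumes \<tau>: "\<tau> permutes {1..n}" and \<sigma>: "\<sigma> permutes {1..n}"
  shows "left_weak_le n \<tau> \<sigma> \<longleftrightarrow> inversions n \<tau> \<subseteq> inversions n \<sigma>"
proof -
  let ?T = "inversions n \<tau>" and ?S = "inversions n \<sigma>"
  note fin = finite_inversions[of n]
  have len: "card (inversions n u) = card (?T - ?S) + card (?S - ?T)"
    if "u permutes {1..n}" "\<sigma> = u \<circ> \<tau>" for u
  proof -
    have "card (inversions n u) = card (sym_diff ?T ?S)"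
      unfolding inversions_eq_image[OF \<tau> permutes_inj[OF that(1)]] that(2)
      using inversions_subset
      by (intro card_image inj_on_subset[OF inj_on_image_pair[OF permutes_inj[OF \<tau>]]]) blast
    also have "\<dots> = card (?T - ?S) + card (?S - ?T)"
      using fin by (intro card_Un_disjoint) auto
    finally show ?thesis .
  qed
  have card_eq: "card X = card (X - Y) + card (X \<inter> Y)" if "finite X" for X Y :: "(nat \<times> nat) set"
    using that by (metis add.commute card_Int_Diff)
  \<comment> \<open>Once both sets are split along their intersection, the two sides differ by twice
    \<open>card (?T - ?S)\<close>.\<close>
  have "card ?S = card (?T - ?S) + card (?S - ?T) + card ?T \<longleftrightarrow> card (?T - ?S) = 0"
    using card_eq[OF fin[of \<sigma>], of ?T] card_eq[OF fin[of \<tau>], of ?S] by (auto simp: Int_commute)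
  also have "\<dots> \<longleftrightarrow> ?T \<subseteq> ?S"
    using fin by simp
  finally have key: "card ?S = card (?T - ?S) + card (?S - ?T) + card ?T \<longleftrightarrow> ?T \<subseteq> ?S" .
  have "\<sigma> = (\<sigma> \<circ> inv_into UNIV \<tau>) \<circ> \<tau>"
    using permutes_inv_o[OF \<tau>] by (simp add: comp_assoc)
  moreover have "(\<sigma> \<circ> inv_into UNIV \<tau>) permutes {1..n}"
    using permutes_compose[OF permutes_inv[OF \<tau>] \<sigma>] .
  ultimately show ?thesis
    unfolding left_weak_le_def perm_length_eq_card_inversions
    using len key by metis
qed

text \<open>Labels follow the letters and, among equal letters, the positions; hence ties never
  create an inversion.\<close>

lemma inversions_Std:
  "inversions (length w) (Std w) =
    {(i, j) \<in> position_pairs (length w). w ! (i - 1) > w ! (j - 1)}"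
proof -
  let ?n = "length w"
  define lt where "lt = (\<lambda>j i. w ! (j - 1) < w ! (i - 1) \<or> (w ! (j - 1) = w ! (i - 1) \<and> j \<le> i))"
  have less: "Std w i < Std w j"
    if "lt i j" "i \<noteq> j" "i \<in> {1..?n}" "j \<in> {1..?n}" for i j
  proof -
    have "{k \<in> {1..?n}. lt k i} \<subseteq> {k \<in> {1..?n}. lt k j}"
      "j \<in> {k \<in> {1..?n}. lt k j}" "j \<notin> {k \<in> {1..?n}. lt k i}"
      using that by (auto simp: lt_def)
    then have "{k \<in> {1..?n}. lt k i} \<subset> {k \<in> {1..?n}. lt k j}" by blast
    then have "card {k \<in> {1..?n}. lt k i} < card {k \<in> {1..?n}. lt k j}"
      by (intro psubset_card_mono) auto
    then show ?thesis using that by (simp add: Std_def lt_def)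
  qed
  have "Std w i > Std w j \<longleftrightarrow> w ! (i - 1) > w ! (j - 1)"
    if "(i, j) \<in> position_pairs ?n" for i j
  proof (cases "lt i j")
    case True
    then show ?thesis using less[of i j] that
      by (auto simp: lt_def position_pairs_def)
  next
    case False
    then have "lt j i" by (auto simp: lt_def)
    then show ?thesis using less[of j i] that False
      by (auto simp: lt_def position_pairs_def)
  qed
  then show ?thesis by (auto simp: inversions_def)
qed

section \<open>Descent classes\<close>

text \<open>For a descent set \<open>D\<close>, these are the inversion sets of the minimal and of the maximal
  permutation of the descent class.\<close>

definition all_in :: "nat \<Rightarrow> nat set \<Rightarrow> (nat \<times> nat) set" where
  "all_in n D = {(i, j) \<in> position_pairs n. {i..<j} \<subseteq> D}"

definition some_in :: "nat \<Rightarrow> nat set \<Rightarrow> (nat \<times> nat) set" where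
  "some_in n D = {(i, j) \<in> position_pairs n. {i..<j} \<inter> D \<noteq> {}}"

lemma decreasing_if_descents:
  fixes \<sigma> :: "nat \<Rightarrow> 'a::order"
  assumes "i < j" "\<And>k. i \<le> k \<Longrightarrow> k < j \<Longrightarrow> \<sigma> k > \<sigma> (Suc k)"
  shows "\<sigma> i > \<sigma> j"
  using assms
proof (induction j)
  case (Suc j)
  show ?case
  proof (cases "i = j")
    case False
    then have "\<sigma> j < \<sigma> i" "\<sigma> (Suc j) < \<sigma> j" using Suc by simp_all
    then show ?thesis by (rule less_trans[rotated])
  qed (use Suc in simp)
qed simp

lemma increasing_if_ascents:
  fixes \<sigma> :: "nat \<Rightarrow> 'a::order"
  assumes "i < j" "\<And>k. i \<le> k \<Longrightarrow> k < j \<Longrightarrow> \<sigma> k < \<sigma> (Suc k)"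
  shows "\<sigma> i < \<sigma> j"
  using assms
proof (induction j)
  case (Suc j)
  show ?case
  proof (cases "i = j")
    case False
    then have "\<sigma> i < \<sigma> j" using Suc by simp
    also have "\<sigma> j < \<sigma> (Suc j)" using Suc by simp
    finally show ?thesis .
  qed (use Suc in simp)
qed simp

text \<open>A descent class is an interval of the left weak order.\<close>

lemma descent_set_eq_iff:
  assumes \<sigma>: "\<sigma> permutes {1..n}" and D: "D \<subseteq> {1..<n}"
  shows "descent_set n \<sigma> = D \<longleftrightarrow>
    all_in n D \<subseteq> inversions n \<sigma> \<and> inversions n \<sigma> \<subseteq> some_in n D"
proof
  assume des: "descent_set n \<sigma> = D"
  have inj: "\<sigma> i \<noteq> \<sigma> (Suc i)" for i
    using permutes_inj[OF \<sigma>] by (metis injD n_not_Suc_n)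
  have D_iff: "k \<in> D \<longleftrightarrow> 1 \<le> k \<and> k < n \<and> \<sigma> k > \<sigma> (Suc k)" for k
    using des by (auto simp: descent_set_def)
  have "\<sigma> i > \<sigma> j" if ij: "(i, j) \<in> all_in n D" for i j
  proof (rule decreasing_if_descents[of i j \<sigma>])
    show "i < j" using ij by (simp add: all_in_def position_pairs_def)
    fix k assume "i \<le> k" "k < j"
    then have "k \<in> D" using ij by (auto simp: all_in_def)
    then show "\<sigma> (Suc k) < \<sigma> k" using D_iff by simp
  qed
  moreover have "\<not> \<sigma> i > \<sigma> j" if ij: "(i, j) \<in> position_pairs n - some_in n D" for i j
  proof -
    have "\<sigma> k < \<sigma> (Suc k)" if "i \<le> k" "k < j" for k
    proof -
      have "k \<notin> D" "1 \<le> k" "k < n"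
        using ij that by (auto simp: some_in_def position_pairs_def)
      then show ?thesis using D_iff[of k] inj[of k] by simp
    qed
    then have "\<sigma> i < \<sigma> j"
      using ij by (intro increasing_if_ascents[of i j \<sigma>]) (auto simp: position_pairs_def)
    then show ?thesis by simp
  qed
  ultimately show "all_in n D \<subseteq> inversions n \<sigma> \<and> inversions n \<sigma> \<subseteq> some_in n D"
    by (auto simp: inversions_def all_in_def)
next
  assume sub: "all_in n D \<subseteq> inversions n \<sigma> \<and> inversions n \<sigma> \<subseteq> some_in n D"
  have "i \<in> descent_set n \<sigma> \<longleftrightarrow> (i, Suc i) \<in> inversions n \<sigma>" for i
    by (auto simp: descent_set_def inversions_def position_pairs_def)
  \<comment> \<open>On adjacent pairs the lower and the upper bound coincide, so together they
    decide each descent.\<close>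
  moreover have "i \<in> D \<longleftrightarrow> (i, Suc i) \<in> all_in n D" "i \<in> D \<longleftrightarrow> (i, Suc i) \<in> some_in n D" for i
    using D by (auto simp: all_in_def some_in_def position_pairs_def)
  ultimately show "descent_set n \<sigma> = D"
    using sub by blast
qed

lemma all_in_subset_some_in: "all_in n D \<subseteq> some_in n D"
proof clarify
  fix i j assume ij: "(i, j) \<in> all_in n D"
  then have "i \<in> {i..<j} \<inter> D" by (auto simp: all_in_def position_pairs_def)
  then show "(i, j) \<in> some_in n D" using ij by (auto simp: all_in_def some_in_def)
qed

section \<open>Permutations with prescribed inversion sets\<close>

lemma nth_map_from_1:
  assumes "i \<in> {1..n}"
  shows "map f [1..<Suc n] ! (i - 1) = f i"
proof -
  have "i - 1 < length [1..<Suc n]" using assms by auto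
  then have "map f [1..<Suc n] ! (i - 1) = f ([1..<Suc n] ! (i - 1))" by (rule nth_map)
  also have "[1..<Suc n] ! (i - 1) = i" using assms by (subst nth_upt) auto
  finally show ?thesis .
qed

lemma inversions_Std_map:
  fixes f :: "nat \<Rightarrow> 'a::linorder"
  shows "inversions n (Std (map f [1..<Suc n])) = {(i, j) \<in> position_pairs n. f i > f j}"
proof -
  have len: "length (map f [1..<Suc n]) = n" by simp
  have "map f [1..<Suc n] ! (i - 1) = f i \<and> map f [1..<Suc n] ! (j - 1) = f j"
    if "(i, j) \<in> position_pairs n" for i j
    using that nth_map_from_1[of i n f] nth_map_from_1[of j n f]
    by (simp only: position_pairs_def mem_Collect_eq case_prod_conv)
  then show ?thesis
    using inversions_Std[of "map f [1..<Suc n]"] unfolding len by (auto simp del: upt_Suc)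
qed

text \<open>Standardizing the word of keys \<open>f 1\<close>, ..., \<open>f n\<close> realizes an
  inversion set without any separate check of bijectivity.\<close>

lemma exists_permutes_inversions:
  fixes f :: "nat \<Rightarrow> 'a::linorder"
  shows "\<exists>\<sigma>. \<sigma> permutes {1..n} \<and> inversions n \<sigma> = {(i, j) \<in> position_pairs n. f i > f j}"
  using inversions_Std_map[of n f] Std_permutes[of "map f [1..<Suc n]"]
  by (intro exI[of _ "Std (map f [1..<Suc n])"]) (simp del: upt_Suc)

lemma exists_inversions_all_in:
  "\<exists>\<sigma>. \<sigma> permutes {1..n} \<and> inversions n \<sigma> = all_in n D"
proof -
  \<comment> \<open>Each step lowers the key by 1, and each step over a position outside
    \<open>D\<close> also raises it by \<open>n\<close>. Two positions are at most \<open>n\<close>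
    apart, so one such step already outweighs all the losses between them.\<close>
  let ?a = "\<lambda>i. int n * int (card ({1..<i} - D)) - int i"
  have "?a i > ?a j \<longleftrightarrow> {i..<j} \<subseteq> D" if ij: "(i, j) \<in> position_pairs n" for i j
  proof -
    have split: "{1..<j} - D = ({1..<i} - D) \<union> ({i..<j} - D)"
      using ij by (auto simp: position_pairs_def)
    have "card ({1..<j} - D) = card ({1..<i} - D) + card ({i..<j} - D)"
      unfolding split by (rule card_Un_disjoint) auto
    then have eq: "?a j - ?a i = int n * int (card ({i..<j} - D)) - int (j - i)"
      using ij by (simp add: position_pairs_def algebra_simps of_nat_diff)
    show ?thesis
    proof (cases "{i..<j} \<subseteq> D")
      case True
      then have "{i..<j} - D = {}" by auto
      then have "?a j - ?a i = - int (j - i)" using eq by simp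
      moreover have "i < j" using ij by (simp add: position_pairs_def)
      ultimately have "?a j < ?a i" by linarith
      with True show ?thesis by simp
    next
      case False
      then have "card ({i..<j} - D) \<ge> 1"
        by (metis Diff_eq_empty_iff One_nat_def Suc_leI card_gt_0_iff finite_Diff finite_atLeastLessThan)
      then have "int n * 1 \<le> int n * int (card ({i..<j} - D))"
        by (intro mult_left_mono) auto
      moreover have "int (j - i) \<le> int n" using ij by (auto simp: position_pairs_def)
      ultimately have "?a j \<ge> ?a i" using eq by linarith
      with False show ?thesis by simp
    qed
  qed
  then have "{(i, j) \<in> position_pairs n. ?a i > ?a j} = all_in n D"
    unfolding all_in_def by blast
  then show ?thesis using exists_permutes_inversions[of n ?a] by simp
qed

lemma exists_inversions_some_in:
  "\<exists>\<sigma>. \<sigma> permutes {1..n} \<and> inversions n \<sigma> = some_in n D"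
proof -
  \<comment> \<open>The key drops by 1 after each element of \<open>D\<close> and is constant
    otherwise; standardization makes the constant stretches increasing.\<close>
  let ?a = "\<lambda>i. - int (card ({1..<i} \<inter> D))"
  have "?a i > ?a j \<longleftrightarrow> {i..<j} \<inter> D \<noteq> {}" if ij: "(i, j) \<in> position_pairs n" for i j
  proof -
    have split: "{1..<j} \<inter> D = ({1..<i} \<inter> D) \<union> ({i..<j} \<inter> D)"
      using ij by (auto simp: position_pairs_def)
    have "card ({1..<j} \<inter> D) = card ({1..<i} \<inter> D) + card ({i..<j} \<inter> D)"
      unfolding split by (rule card_Un_disjoint) auto
    moreover have "card ({i..<j} \<inter> D) > 0 \<longleftrightarrow> {i..<j} \<inter> D \<noteq> {}"
      by (simp add: card_gt_0_iff)
    ultimately show ?thesis by linarith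
  qed
  then have "{(i, j) \<in> position_pairs n. ?a i > ?a j} = some_in n D"
    unfolding some_in_def by blast
  then show ?thesis using exists_permutes_inversions[of n ?a] by simp
qed

section \<open>Compositions and descent sets\<close>

fun partial_sums :: "nat \<Rightarrow> nat list \<Rightarrow> nat list" where
  "partial_sums d [] = []"
| "partial_sums d [k] = []"
| "partial_sums d (k # l # I) = (d + k) # partial_sums (d + k) (l # I)"

text \<open>The sum of all parts is left out by \<open>partial_sums\<close>, since the last position
  is never a descent.\<close>

definition descents_of :: "nat list \<Rightarrow> nat set" where
  "descents_of I = set (partial_sums 0 I)"

lemma partial_sums_bounds:
  "I \<in> lists {1..} \<Longrightarrow> i \<in> set (partial_sums d I) \<Longrightarrow> d < i \<and> i < d + sum_list I"
proof (induction d I rule: partial_sums.induct)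
  case (3 d k l I)
  then consider "i = d + k" | "d + k < i \<and> i < d + k + sum_list (l # I)" by auto
  then show ?case using "3.prems" by cases auto
qed auto

lemma strict_sorted_partial_sums:
  "I \<in> lists {1..} \<Longrightarrow> sorted_wrt (<) (partial_sums d I)"
proof (induction d I rule: partial_sums.induct)
  case (3 d k l I)
  then show ?case using partial_sums_bounds[of "l # I" _ "d + k"] by auto
qed auto

lemma set_partial_sums: "set (partial_sums d I) = (+) d ` set (partial_sums 0 I)"
proof (induction d I rule: partial_sums.induct)
  case (3 d k l I)
  \<comment> \<open>The recursion moves the offset, and both \<open>d + k\<close> and
    \<open>k\<close> must be compared with 0; hence an inner induction with an arbitrary
    offset.\<close>
  have shift: "set (partial_sums c (l # I)) = (+) c ` set (partial_sums 0 (l # I))" for c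
  proof (induction I arbitrary: c l)
    case (Cons m I)
    show ?case using Cons.IH[of "c + l" m] Cons.IH[of l m] by (auto simp: image_image add.assoc)
  qed simp
  show ?case using shift[of "d + k"] shift[of k] by (auto simp: image_image add.assoc)
qed auto

text \<open>Being free of the offset, this recursion lets later arguments peel off the first part of
  a composition.\<close>

lemma descents_of_Cons:
  "descents_of (k # I) = (if I = [] then {} else insert k ((+) k ` descents_of I))"
proof (cases I)
  case (Cons l J)
  then show ?thesis using set_partial_sums[of k I] by (simp add: descents_of_def)
qed (simp add: descents_of_def)

lemma descents_of_subset: "I \<in> lists {1..} \<Longrightarrow> descents_of I \<subseteq> {1..<sum_list I}"
proof
  fix i assume "I \<in> lists {1..}" "i \<in> descents_of I"
  then show "i \<in> {1..<sum_list I}"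
    using partial_sums_bounds[of I i 0] by (simp add: descents_of_def)
qed

text \<open>Taking differences undoes taking partial sums. The offset \<open>d\<close> is general so
  that the induction can restart at the next breakpoint \<open>d + k\<close>.\<close>

lemma differences_eq_iff:
  assumes "I \<in> lists {1..}" "I \<noteq> []" "sorted_wrt (<) (d # ds @ [d + sum_list I])"
  shows "map2 (-) (ds @ [d + sum_list I]) (d # ds) = I \<longleftrightarrow> ds = partial_sums d I"
  using assms
proof (induction d I arbitrary: ds rule: partial_sums.induct)
  case (2 d k)
  then show ?case by (cases ds) auto
next
  case (3 d k l I)
  show ?case
  proof (cases ds)
    case (Cons e es)
    show ?thesis
    proof (cases "e = d + k")
      case True
      then show ?thesis using "3.IH"[of es] "3.prems" Cons by (simp add: add.assoc)
    next
      case False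
      then show ?thesis using "3.prems" Cons by auto
    qed
  qed auto
qed auto

lemma descent_composition_eq_iff:
  assumes I: "I \<in> lists {1..}"
  shows "descent_composition (sum_list I) \<sigma> = I \<longleftrightarrow> descent_set (sum_list I) \<sigma> = descents_of I"
proof (cases "I = []")
  case True
  then show ?thesis by (simp add: descent_composition_def descent_set_def descents_of_def)
next
  case False
  let ?n = "sum_list I"
  let ?ds = "sorted_list_of_set (descent_set ?n \<sigma>)"
  have fin: "finite (descent_set ?n \<sigma>)" by (simp add: descent_set_def)
  have pos: "?n > 0" using False I by (cases I) auto
  have "sorted_wrt (<) (0 # ?ds @ [0 + ?n])"
    using fin pos by (auto simp: sorted_wrt_append descent_set_def)
  from differences_eq_iff[OF I False this]
  have *: "map2 (-) (?ds @ [?n]) (0 # ?ds) = I \<longleftrightarrow> ?ds = partial_sums 0 I"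
    by simp
  have "descent_composition ?n \<sigma> = I \<longleftrightarrow> ?ds = partial_sums 0 I"
    using pos by (simp only: *[symmetric] descent_composition_def Let_def less_numeral_extra if_False neq0_conv[symmetric])
  also have "\<dots> \<longleftrightarrow> descent_set ?n \<sigma> = descents_of I"
    unfolding descents_of_def
    \<comment> \<open>A strictly sorted list is determined by its set, so the two lists may be
      compared as sets.\<close>
    using fin strict_sorted_partial_sums[OF I, of 0]
    by (metis set_sorted_list_of_set sorted_list_of_set.idem_if_sorted_distinct strict_sorted_iff)
  finally show ?thesis .
qed

lemma descent_class_iff:
  assumes "I \<in> lists {1..}"
  shows "\<sigma> \<in> descent_class I \<longleftrightarrow>
    \<sigma> permutes {1..sum_list I} \<and> descent_set (sum_list I) \<sigma> = descents_of I"
  using descent_composition_eq_iff[OF assms] by (auto simp: descent_class_def)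

section \<open>Extremal permutations of a descent class\<close>

lemma alpha_perm:
  assumes I: "I \<in> lists {1..}"
  shows "alpha_perm I permutes {1..sum_list I}"
    and "inversions (sum_list I) (alpha_perm I) = all_in (sum_list I) (descents_of I)"
proof -
  let ?n = "sum_list I" and ?D = "descents_of I"
  obtain \<alpha> where \<alpha>: "\<alpha> permutes {1..?n}" "inversions ?n \<alpha> = all_in ?n ?D"
    using exists_inversions_all_in by blast
  note mem = descent_class_iff[OF I] descent_set_eq_iff[OF _ descents_of_subset[OF I]]
  have cls: "\<alpha> \<in> descent_class I"
    using \<alpha> all_in_subset_some_in by (auto simp: mem)
  \<comment> \<open>Inclusion of inversion sets gives minimal length. It also gives uniqueness: a
    member of the same length has the same inversions, hence is the same permutation.\<close>
  have le: "inversions ?n \<alpha> \<subseteq> inversions ?n \<tau>" if "\<tau> \<in> descent_class I" for \<tau>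
    using that \<alpha> by (auto simp: mem)
  have "alpha_perm I = \<alpha>"
    unfolding alpha_perm_def
  proof (rule the_equality)
    show "is_arg_min (perm_length ?n) (\<lambda>\<tau>. \<tau> \<in> descent_class I) \<alpha>"
      using cls card_mono[OF finite_inversions le]
      by (auto simp: is_arg_min_linorder perm_length_eq_card_inversions)
  next
    fix \<sigma> assume "is_arg_min (perm_length ?n) (\<lambda>\<tau>. \<tau> \<in> descent_class I) \<sigma>"
    then have \<sigma>: "\<sigma> \<in> descent_class I" "card (inversions ?n \<sigma>) \<le> card (inversions ?n \<alpha>)"
      using cls by (auto simp: is_arg_min_linorder perm_length_eq_card_inversions)
    have "inversions ?n \<alpha> = inversions ?n \<sigma>"
      using card_seteq[OF finite_inversions le[OF \<sigma>(1)] \<sigma>(2)] .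
    then show "\<sigma> = \<alpha>"
      using \<sigma>(1) \<alpha>(1) inversions_inject by (metis mem(1))
  qed
  with \<alpha> show "alpha_perm I permutes {1..?n}" "inversions ?n (alpha_perm I) = all_in ?n ?D"
    by simp_all
qed

lemma omega_perm:
  assumes I: "I \<in> lists {1..}"
  shows "omega_perm I permutes {1..sum_list I}"
    and "inversions (sum_list I) (omega_perm I) = some_in (sum_list I) (descents_of I)"
proof -
  let ?n = "sum_list I" and ?D = "descents_of I"
  obtain \<omega> where \<omega>: "\<omega> permutes {1..?n}" "inversions ?n \<omega> = some_in ?n ?D"
    using exists_inversions_some_in by blast
  note mem = descent_class_iff[OF I] descent_set_eq_iff[OF _ descents_of_subset[OF I]]
  have cls: "\<omega> \<in> descent_class I"
    using \<omega> all_in_subset_some_in by (auto simp: mem)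
  have le: "inversions ?n \<tau> \<subseteq> inversions ?n \<omega>" if "\<tau> \<in> descent_class I" for \<tau>
    using that \<omega> by (auto simp: mem)
  have "omega_perm I = \<omega>"
    unfolding omega_perm_def
  proof (rule the_equality)
    show "is_arg_max (perm_length ?n) (\<lambda>\<tau>. \<tau> \<in> descent_class I) \<omega>"
      using cls card_mono[OF finite_inversions le]
      by (auto simp: is_arg_max_linorder perm_length_eq_card_inversions)
  next
    fix \<sigma> assume "is_arg_max (perm_length ?n) (\<lambda>\<tau>. \<tau> \<in> descent_class I) \<sigma>"
    then have \<sigma>: "\<sigma> \<in> descent_class I" "card (inversions ?n \<omega>) \<le> card (inversions ?n \<sigma>)"
      using cls by (auto simp: is_arg_max_linorder perm_length_eq_card_inversions)
    have "inversions ?n \<sigma> = inversions ?n \<omega>"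
      using card_seteq[OF finite_inversions le[OF \<sigma>(1)] \<sigma>(2)] .
    then show "\<sigma> = \<omega>"
      using \<sigma>(1) \<omega>(1) inversions_inject by (metis mem(1))
  qed
  with \<omega> show "omega_perm I permutes {1..?n}" "inversions ?n (omega_perm I) = some_in ?n ?D"
    by simp_all
qed

text \<open>Right multiplication by \<open>\<omega>(K)\<inverse>\<close> reverses the order on the interval from \<open>\<alpha>(K)\<close> to
  \<open>\<omega>(K)\<close>, mapping it onto the interval from the identity to \<open>diam K\<close>.\<close>

lemma left_weak_le_diam_iff:
  assumes I: "I \<in> lists {1..}" and \<tau>: "\<tau> permutes {1..sum_list I}"
  shows "left_weak_le (sum_list I) \<tau> (diam I) \<longleftrightarrow>
    descent_set (sum_list I) (\<tau> \<circ> omega_perm I) = descents_of I"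
proof -
  let ?n = "sum_list I" and ?D = "descents_of I" and ?\<omega> = "omega_perm I"
  note \<alpha> = alpha_perm[OF I] and \<omega> = omega_perm[OF I]
  have diam: "diam I permutes {1..?n}"
    unfolding diam_def using permutes_compose[OF permutes_inv[OF \<omega>(1)] \<alpha>(1)] .
  have comp: "diam I \<circ> ?\<omega> = alpha_perm I"
    unfolding diam_def using permutes_inv_o(2)[OF \<omega>(1)] by (simp add: comp_assoc)
  have \<tau>\<omega>: "\<tau> \<circ> ?\<omega> permutes {1..?n}"
    using permutes_compose[OF \<omega>(1) \<tau>] .
  \<comment> \<open>\<open>?X\<close> and \<open>?Y\<close> record what changes from
    \<open>?\<omega>\<close> to \<open>\<tau> \<circ> ?\<omega>\<close> and to
    \<open>alpha_perm I\<close>; their images under \<open>image_pair ?\<omega>\<close> are the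
    inversion sets of \<open>\<tau>\<close> and of \<open>diam I\<close>.\<close>
  let ?X = "sym_diff (some_in ?n ?D) (inversions ?n (\<tau> \<circ> ?\<omega>))"
  let ?Y = "sym_diff (some_in ?n ?D) (all_in ?n ?D)"
  have sub: "?X \<subseteq> position_pairs ?n" "?Y \<subseteq> position_pairs ?n"
    by (auto simp: some_in_def all_in_def inversions_def)
  have "left_weak_le ?n \<tau> (diam I) \<longleftrightarrow> inversions ?n \<tau> \<subseteq> inversions ?n (diam I)"
    using left_weak_le_iff_inversions[OF \<tau> diam] .
  also have "\<dots> \<longleftrightarrow> image_pair ?\<omega> ` ?X \<subseteq> image_pair ?\<omega> ` ?Y"
    using inversions_eq_image[OF \<omega>(1) permutes_inj[OF \<tau>]]
      inversions_eq_image[OF \<omega>(1) permutes_inj[OF diam]] comp \<omega>(2) \<alpha>(2) by simp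
  also have "\<dots> \<longleftrightarrow> ?X \<subseteq> ?Y"
    by (rule inj_on_image_subset_iff[OF inj_on_image_pair[OF permutes_inj[OF \<omega>(1)]] sub])
  \<comment> \<open>\<open>?Y\<close> is \<open>some_in\<close> minus \<open>all_in\<close>. A pair
    of \<open>?X\<close> outside \<open>some_in\<close> is an excess inversion of
    \<open>\<tau> \<circ> ?\<omega>\<close>, and one inside \<open>all_in\<close> is a missing
    inversion.\<close>
  also have "\<dots> \<longleftrightarrow> all_in ?n ?D \<subseteq> inversions ?n (\<tau> \<circ> ?\<omega>) \<and>
      inversions ?n (\<tau> \<circ> ?\<omega>) \<subseteq> some_in ?n ?D"
    using all_in_subset_some_in by blast
  also have "\<dots> \<longleftrightarrow> descent_set ?n (\<tau> \<circ> ?\<omega>) = ?D"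
    using descent_set_eq_iff[OF \<tau>\<omega> descents_of_subset[OF I]] by simp
  finally show ?thesis .
qed

section \<open>Cutting words into blocks\<close>

fun blocks :: "nat list \<Rightarrow> 'a list \<Rightarrow> 'a list list" where
  "blocks [] w = []"
| "blocks (k # I) w = take k w # blocks I (drop k w)"

lemma concat_blocks: "length w = sum_list I \<Longrightarrow> concat (blocks I w) = w"
  by (induction I w rule: blocks.induct) auto

lemma map_length_blocks: "length w = sum_list I \<Longrightarrow> map length (blocks I w) = I"
  by (induction I w rule: blocks.induct) auto

lemma length_blocks: "length (blocks I w) = length I"
  by (induction I w rule: blocks.induct) auto

lemma blocks_concat: "blocks (map length us) (concat us) = us"
  by (induction us) auto

lemma blocks_append:
  "blocks (I @ J) w = blocks I (take (sum_list I) w) @ blocks J (drop (sum_list I) w)"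
proof (induction I arbitrary: w)
  case (Cons k I)
  then show ?case by (simp add: min_def drop_take add.commute)
qed simp

lemma Nil_notin_blocks:
  assumes "I \<in> lists {1..}" "length w = sum_list I"
  shows "[] \<notin> set (blocks I w)"
proof
  assume "[] \<in> set (blocks I w)"
  then have "length ([] :: 'a list) \<in> set (map length (blocks I w))"
    unfolding set_map by (rule imageI)
  then show False
    using assms unfolding map_length_blocks[OF assms(2)] by auto
qed

section \<open>Order conditions on words in terms of blocks\<close>

lemma all_pairs_split:
  fixes k s :: nat
  shows "(\<forall>i j. i < j \<longrightarrow> j < k + s \<longrightarrow> P i j) \<longleftrightarrow>
    (\<forall>i j. i < j \<longrightarrow> j < k \<longrightarrow> P i j) \<and> (\<forall>i j. i < k \<longrightarrow> j < s \<longrightarrow> P i (k + j)) \<and>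
    (\<forall>i j. i < j \<longrightarrow> j < s \<longrightarrow> P (k + i) (k + j))" (is "?L \<longleftrightarrow> ?R")
proof
  assume R: ?R
  show ?L
  proof (intro allI impI)
    fix i j assume ij: "i < j" "j < k + s"
    consider "j < k" | "i < k" "k \<le> j" | "k \<le> i" by linarith
    then show "P i j"
    proof cases
      case 2
      then have "P i (k + (j - k))" using R ij by (metis less_diff_conv2 add.commute)
      with 2 show ?thesis by simp
    next
      case 3
      then have "P (k + (i - k)) (k + (j - k))"
        using R ij by (metis add.commute diff_less_mono less_diff_conv2 less_imp_le order_trans)
      with 3 ij show ?thesis by simp
    qed (use R ij in blast)
  qed
qed auto

text \<open>Two positions lie in different blocks iff a block boundary separates them, so the
  condition asks for weak increase inside blocks and strict decrease across. Indices start at 0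
  here, so a boundary \<open>d\<close> separates \<open>i\<close> from \<open>j\<close> when
  \<open>i < d\<close> and \<open>d \<le> j\<close>.\<close>

lemma descent_free_iff_sorted_blocks:
  fixes w :: "'a::linorder list"
  assumes "I \<in> lists {1..}" "length w = sum_list I"
  shows "(\<forall>i j. i < j \<longrightarrow> j < sum_list I \<longrightarrow> (w ! i > w ! j \<longleftrightarrow> {Suc i..j} \<inter> descents_of I \<noteq> {})) \<longleftrightarrow>
    (\<forall>u\<in>set (blocks I w). sorted u) \<and>
    sorted_wrt (\<lambda>u v. \<forall>x\<in>set u. \<forall>y\<in>set v. x > y) (blocks I w)"
  using assms
proof (induction I arbitrary: w rule: list.induct)
  case (Cons k I)
  define u where "u = take k w"
  define v where "v = drop k w"
  let ?s = "sum_list I" and ?D = "descents_of I" and ?D' = "descents_of (k # I)"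
  have w: "w = u @ v" and u: "length u = k" and v: "length v = ?s"
    using Cons.prems by (auto simp: u_def v_def)
  have I: "I \<in> lists {1..}" using Cons.prems by simp
  have low: "{Suc i..j} \<inter> ?D' = {}" if "j < k" for i j
    using that by (auto simp: descents_of_Cons)
  have mid: "{Suc i..k + j} \<inter> ?D' \<noteq> {}" if "i < k" "j < ?s" for i j
  proof -
    have "k \<in> {Suc i..k + j} \<inter> ?D'"
      using that by (auto simp: descents_of_Cons)
    then show ?thesis by blast
  qed
  have high: "{Suc (k + i)..k + j} \<inter> ?D' \<noteq> {} \<longleftrightarrow> {Suc i..j} \<inter> ?D \<noteq> {}" if "j < ?s" for i j
  proof -
    have "{Suc (k + i)..k + j} \<inter> ?D' = (+) k ` ({Suc i..j} \<inter> ?D)"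
      using that by (auto simp: descents_of_Cons)
    then show ?thesis by simp
  qed
  have within: "(\<forall>i j. i < j \<longrightarrow> j < k \<longrightarrow> (w ! i > w ! j \<longleftrightarrow> {Suc i..j} \<inter> ?D' \<noteq> {})) \<longleftrightarrow> sorted u"
    unfolding sorted_iff_nth_mono_less u using low by (auto simp: w u nth_append not_less)
  have "(\<forall>i j. i < k \<longrightarrow> j < ?s \<longrightarrow> (w ! i > w ! (k + j) \<longleftrightarrow> {Suc i..k + j} \<inter> ?D' \<noteq> {})) \<longleftrightarrow>
      (\<forall>i<k. \<forall>j<?s. u ! i > v ! j)"
    using mid by (auto simp: w u nth_append)
  also have "\<dots> \<longleftrightarrow> (\<forall>x\<in>set u. \<forall>y\<in>set v. x > y)"
    unfolding u[symmetric] v[symmetric] by (auto simp: all_set_conv_all_nth)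
  also have "set v = \<Union> (set ` set (blocks I v))"
    using concat_blocks[OF v] by (metis set_concat)
  finally have across:
    "(\<forall>i j. i < k \<longrightarrow> j < ?s \<longrightarrow> (w ! i > w ! (k + j) \<longleftrightarrow> {Suc i..k + j} \<inter> ?D' \<noteq> {})) \<longleftrightarrow>
      (\<forall>b\<in>set (blocks I v). \<forall>x\<in>set u. \<forall>y\<in>set b. x > y)"
    by blast
  have "(\<forall>i j. i < j \<longrightarrow> j < ?s \<longrightarrow> (w ! (k + i) > w ! (k + j) \<longleftrightarrow> {Suc (k + i)..k + j} \<inter> ?D' \<noteq> {}))
      \<longleftrightarrow> (\<forall>i j. i < j \<longrightarrow> j < ?s \<longrightarrow> (v ! i > v ! j \<longleftrightarrow> {Suc i..j} \<inter> ?D \<noteq> {}))"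
    using high by (auto simp: w u nth_append)
  note rest = this[unfolded Cons.IH[OF I v]]
  have blk: "blocks (k # I) w = u # blocks I v" by (simp add: u_def v_def)
  show ?case
    unfolding sum_list.Cons all_pairs_split within across rest blk by auto
qed simp

text \<open>In a nonempty sorted block \<open>hd\<close> is the minimum and \<open>last\<close> the
  maximum, which reduces separation of two blocks to one comparison. Separation is transitive
  through a nonempty middle block, so adjacent blocks suffice.\<close>

lemma separated_iff_successively:
  fixes us :: "'a::linorder list list"
  assumes "[] \<notin> set us" "\<forall>u\<in>set us. sorted u"
  shows "sorted_wrt (\<lambda>u v. \<forall>x\<in>set u. \<forall>y\<in>set v. x > y) us \<longleftrightarrow>
    successively (\<lambda>u v. hd u > last v) us"
proof -
  let ?Q = "\<lambda>u v :: 'a list. \<forall>x\<in>set u. \<forall>y\<in>set v. x > y"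
  have Q: "?Q u v \<longleftrightarrow> hd u > last v" if "u \<in> set us" "v \<in> set us" for u v
  proof -
    have "u \<noteq> []" "v \<noteq> []" "sorted u" "sorted v" using that assms by auto
    then have "hd u \<in> set u" "last v \<in> set v" "\<forall>x\<in>set u. hd u \<le> x" "\<forall>y\<in>set v. y \<le> last v"
      by (auto simp: hd_in_set last_in_set) (metis list.collapse set_ConsD sorted_simps(2) order_refl,
        metis append_butlast_last_id in_set_conv_decomp sorted_append set_ConsD empty_iff empty_set
          append_is_Nil_conv Un_iff set_append order_refl list.set_intros(1))
    then show ?thesis by (meson le_less_trans less_le_trans)
  qed
  have "successively ?Q us \<longleftrightarrow> sorted_wrt ?Q us"
  proof (rule successively_iff_sorted_wrt_strong)
    fix u v x assume m: "u \<in> set us" "v \<in> set us" "x \<in> set us" and uv: "?Q u v" and vx: "?Q v x"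
    have "hd v \<in> set v" using m assms by (metis hd_in_set)
    then show "?Q u x" using uv vx by (meson less_trans)
  qed
  moreover have "successively ?Q us \<longleftrightarrow> successively (\<lambda>u v. hd u > last v) us"
    by (rule successively_cong) (use Q in auto)
  ultimately show ?thesis by simp
qed

text \<open>Steps inside a block express sortedness; a step over a boundary compares the last letter
  of a block with the first of the next. Both inequalities are weak because this pattern will
  describe comparisons whose ties are broken by position.\<close>

lemma adjacent_pattern_iff:
  fixes y :: "'a::linorder list"
  assumes "I \<in> lists {1..}" "length y = sum_list I"
  shows "(\<forall>i. Suc i < sum_list I \<longrightarrow>
      (if Suc i \<in> descents_of I then y ! Suc i \<le> y ! i else y ! i \<le> y ! Suc i)) \<longleftrightarrow>
    (\<forall>u\<in>set (blocks I y). sorted u) \<and> successively (\<lambda>u v. hd v \<le> last u) (blocks I y)"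
  using assms
proof (induction I arbitrary: y rule: list.induct)
  case (Cons k I)
  define u where "u = take k y"
  define v where "v = drop k y"
  let ?s = "sum_list I" and ?D = "descents_of I" and ?D' = "descents_of (k # I)"
  have y: "y = u @ v" and u: "length u = k" and v: "length v = ?s" and k: "k > 0"
    using Cons.prems by (auto simp: u_def v_def)
  have I: "I \<in> lists {1..}" using Cons.prems by simp
  have blk: "blocks (k # I) y = u # blocks I v" by (simp add: u_def v_def)
  let ?P = "\<lambda>i. if Suc i \<in> ?D' then y ! Suc i \<le> y ! i else y ! i \<le> y ! Suc i"
  have low: "?P i \<longleftrightarrow> u ! i \<le> u ! Suc i" if "Suc i < k" for i
  proof -
    have "Suc i \<notin> ?D'" using that by (auto simp: descents_of_Cons)
    then show ?thesis using that by (simp add: y u nth_append)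
  qed
  \<comment> \<open>A single block has no boundary, hence no step at index
    \<open>k - 1\<close>.\<close>
  show ?case
  proof (cases "I = []")
    case True
    then show ?thesis
      using low unfolding blk by (auto simp: sorted_iff_nth_Suc u)
  next
    case False
    then obtain l J where J: "I = l # J" "l > 0" using I by (cases I) auto
    have s: "?s > 0" using J by simp
    have mid: "?P (k - 1) \<longleftrightarrow> hd v \<le> last u"
    proof -
      have "k \<in> ?D'" "u \<noteq> []" using False k u by (auto simp: descents_of_Cons)
      moreover have "v \<noteq> []" using s v by (metis length_0_conv less_irrefl)
      ultimately show ?thesis using k by (simp add: y u nth_append hd_conv_nth last_conv_nth)
    qed
    have high: "?P (k + i) \<longleftrightarrow> (if Suc i \<in> ?D then v ! Suc i \<le> v ! i else v ! i \<le> v ! Suc i)"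
      if "Suc i < ?s" for i
    proof -
      have "Suc (k + i) \<in> ?D' \<longleftrightarrow> Suc i \<in> ?D"
        using False by (auto simp: descents_of_Cons simp flip: add_Suc_right)
      then show ?thesis by (simp add: y u nth_append)
    qed
    have hd_v: "hd (hd (blocks I v)) = hd v"
      using J by simp
    have split: "(\<forall>i. Suc i < k + ?s \<longrightarrow> R i) \<longleftrightarrow>
        (\<forall>i. Suc i < k \<longrightarrow> R i) \<and> R (k - 1) \<and> (\<forall>i. Suc i < ?s \<longrightarrow> R (k + i))" for R
    proof (intro iffI conjI allI impI)
      fix i assume R: "(\<forall>i. Suc i < k \<longrightarrow> R i) \<and> R (k - 1) \<and> (\<forall>i. Suc i < ?s \<longrightarrow> R (k + i))"
        and i: "Suc i < k + ?s"
      consider "Suc i < k" | "i = k - 1" | "i = k + (i - k)" "Suc (i - k) < ?s"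
        using i k by linarith
      then show "R i" using R by cases (blast, blast, metis)
    qed (use k s in auto)
    have "blocks I v \<noteq> []" using J by simp
    then have "(\<forall>u\<in>set (blocks (k # I) y). sorted u) \<and>
        successively (\<lambda>u v. hd v \<le> last u) (blocks (k # I) y) \<longleftrightarrow>
      sorted u \<and> hd v \<le> last u \<and>
      (\<forall>u\<in>set (blocks I v). sorted u) \<and> successively (\<lambda>u v. hd v \<le> last u) (blocks I v)"
      unfolding blk successively_Cons hd_v by auto
    also have "\<dots> \<longleftrightarrow> (\<forall>i. Suc i < k \<longrightarrow> ?P i) \<and> ?P (k - 1) \<and> (\<forall>i. Suc i < ?s \<longrightarrow> ?P (k + i))"
      unfolding Cons.IH[OF I v, symmetric] sorted_iff_nth_Suc[of u] u mid using low high by simp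
    finally show ?thesis
      unfolding sum_list.Cons split by blast
  qed
qed simp

section \<open>The maximal permutation read block by block\<close>

lemma omega_perm_Cons:
  assumes I: "k # I \<in> lists {1..}" and p: "p \<in> {1..k + sum_list I}"
  shows "omega_perm (k # I) p = (if p \<le> k then sum_list I + p else omega_perm I (p - k))"
proof -
  let ?s = "sum_list I" and ?n = "k + sum_list I"
  have I': "I \<in> lists {1..}" using I by simp
  note \<omega> = omega_perm[OF I']
  \<comment> \<open>Blocks of the maximal permutation increase and each exceeds the next, so the
    first \<open>k\<close> positions carry the \<open>k\<close> largest values. The function
    \<open>f\<close> is built this way and then identified by its inversion set.\<close>
  define f where "f = (\<lambda>p. if p \<in> {1..?n} then if p \<le> k then ?s + p else omega_perm I (p - k) else p)"
  have low: "f p = ?s + p" if "1 \<le> p" "p \<le> k" for p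
    using that by (simp add: f_def)
  have high: "f (k + p) = omega_perm I p" "f (k + p) \<in> {1..?s}" if "p \<in> {1..?s}" for p
    using that permutes_in_image[OF \<omega>(1), of p] by (auto simp: f_def)
  have high': "f p = omega_perm I (p - k)" "f p \<in> {1..?s}" if "p \<in> {1..?n}" "\<not> p \<le> k" for p
  proof -
    have "p - k \<in> {1..?s}" "k + (p - k) = p" using that by auto
    then show "f p = omega_perm I (p - k)" "f p \<in> {1..?s}"
      using high[of "p - k"] by simp_all
  qed
  have inversion: "f i > f j \<longleftrightarrow> {i..<j} \<inter> descents_of (k # I) \<noteq> {}"
    if ij: "(i, j) \<in> position_pairs ?n" for i j
  proof -
    have b: "1 \<le> i" "i < j" "j \<le> ?n" using ij by (auto simp: position_pairs_def)
    consider "j \<le> k" | "i \<le> k" "k < j" | "k < i" by linarith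
    then show ?thesis
    proof cases
      case 1
      then have "{i..<j} \<inter> descents_of (k # I) = {}"
        by (auto simp: descents_of_Cons)
      then show ?thesis using b 1 low by simp
    next
      case 2
      have "f (k + (j - k)) \<in> {1..?s}" by (rule high(2)) (use b 2 in auto)
      then have "f j < f i" using b 2 low[of i] by simp
      moreover have "k \<in> {i..<j} \<inter> descents_of (k # I)"
        using b 2 by (auto simp: descents_of_Cons)
      ultimately show ?thesis by blast
    next
      case 3
      define i' j' where "i' = i - k" and "j' = j - k"
      have ij': "i = k + i'" "j = k + j'" "i' \<in> {1..?s}" "j' \<in> {1..?s}" "i' < j'"
        using b 3 by (auto simp: i'_def j'_def)
      have "f i > f j \<longleftrightarrow> (i', j') \<in> inversions ?s (omega_perm I)"
        using ij' high(1) by (simp add: inversions_def position_pairs_def)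
      also have "\<dots> \<longleftrightarrow> {i'..<j'} \<inter> descents_of I \<noteq> {}"
        using ij' by (simp add: \<omega>(2) some_in_def position_pairs_def)
      also have "\<dots> \<longleftrightarrow> (+) k ` ({i'..<j'} \<inter> descents_of I) \<noteq> {}"
        by simp
      also have "(+) k ` ({i'..<j'} \<inter> descents_of I) = {i..<j} \<inter> descents_of (k # I)"
        using ij' by (auto simp: descents_of_Cons)
      finally show ?thesis .
    qed
  qed
  have "f ` {1..?n} \<subseteq> {1..?n}"
  proof (rule image_subsetI)
    fix p assume "p \<in> {1..?n}"
    then show "f p \<in> {1..?n}"
      using low[of p] high'(2)[of p] by (cases "p \<le> k") auto
  qed
  moreover have "inj_on f {1..?n}"
  proof (rule inj_onI)
    fix p q assume pq: "p \<in> {1..?n}" "q \<in> {1..?n}" "f p = f q"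
    have "p \<le> k \<longleftrightarrow> f p > ?s" if "p \<in> {1..?n}" for p
      using that low[of p] high'(2)[of p] by (cases "p \<le> k") auto
    then have "p \<le> k \<longleftrightarrow> q \<le> k" using pq by simp
    then show "p = q"
      using pq low[of p] low[of q] high'(1)[of p] high'(1)[of q] permutes_inj[OF \<omega>(1)]
      by (cases "p \<le> k") (auto simp: inj_eq)
  qed
  ultimately have "bij_betw f {1..?n} {1..?n}"
    unfolding bij_betw_def using endo_inj_surj[of "{1..?n}" f] by blast
  then have "f permutes {1..?n}"
    by (rule bij_imp_permutes) (simp only: f_def if_False)
  moreover have "inversions ?n f = some_in ?n (descents_of (k # I))"
    unfolding inversions_def some_in_def using inversion by blast
  ultimately have "f = omega_perm (k # I)"
    using omega_perm[OF I] inversions_inject by simp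
  then have "omega_perm (k # I) p = f p" by simp
  then show ?thesis using p by (simp add: f_def)
qed

text \<open>The first part of \<open>I\<close> reads the last \<open>k\<close> letters of
  \<open>w\<close>, and the remaining parts read what precedes them. This is how the mirror image of
  the composition enters. \<open>Suc p\<close> and \<open>- 1\<close> convert between list indices
  and positions.\<close>

lemma map_omega_perm:
  assumes "I \<in> lists {1..}" "length w = sum_list I"
  shows "map (\<lambda>p. w ! (omega_perm I (Suc p) - 1)) [0..<sum_list I] = concat (rev (blocks (rev I) w))"
  using assms
proof (induction I arbitrary: w rule: list.induct)
  case (Cons k I)
  let ?s = "sum_list I"
  have I: "I \<in> lists {1..}" using Cons.prems by simp
  define v where "v = take ?s w"
  define u where "u = drop ?s w"
  have w: "w = v @ u" and u: "length u = k" and v: "length v = ?s"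
    using Cons.prems by (auto simp: u_def v_def)
  let ?f = "\<lambda>p. w ! (omega_perm (k # I) (Suc p) - 1)"
  have "?f p = u ! p" if "p < k" for p
    using that omega_perm_Cons[OF Cons.prems(1), of "Suc p"] by (simp add: w v nth_append)
  then have "map ?f [0..<k] = u"
    using u by (intro nth_equalityI) auto
  moreover have "?f (p + k) = v ! (omega_perm I (Suc p) - 1)" if "p < ?s" for p
  proof -
    have "omega_perm I (Suc p) \<in> {1..?s}"
      using that permutes_in_image[OF omega_perm(1)[OF I], of "Suc p"] by simp
    then have "omega_perm I (Suc p) - 1 < ?s" by auto
    then show ?thesis
      using that omega_perm_Cons[OF Cons.prems(1), of "Suc (p + k)"] by (simp add: w v nth_append)
  qed
  then have "map (\<lambda>p. ?f (p + k)) [0..<?s] = concat (rev (blocks (rev I) v))"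
    unfolding Cons.IH[OF I v, symmetric] by (intro map_cong) simp_all
  then have "map ?f [k..<?s + k] = concat (rev (blocks (rev I) v))"
    unfolding map_add_upt[symmetric, of k ?s] map_map by (simp add: comp_def)
  moreover have "[0..<sum_list (k # I)] = [0..<k] @ [k..<?s + k]"
    using upt_add_eq_append[of 0 k ?s] by (simp add: add.commute)
  ultimately show ?case
    using u v by (simp add: blocks_append u_def v_def)
qed simp

section \<open>Words occurring in the two series\<close>

lemma G_series_omega_perm:
  fixes w :: "'a::linorder list"
  assumes I: "I \<in> lists {1..}"
  shows "G_series (sum_list I) (omega_perm I) w =
    (if length w = sum_list I \<and> (\<forall>u\<in>set (blocks I w). sorted u) \<and>
        successively (\<lambda>u v. hd u > last v) (blocks I w) then 1 else 0)"
proof (cases "length w = sum_list I")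
  case True
  let ?n = "sum_list I" and ?D = "descents_of I"
  have std: "Std w permutes {1..?n}" using Std_permutes[of w] True by simp
  have "Std w = omega_perm I \<longleftrightarrow> inversions ?n (Std w) = some_in ?n ?D"
    using omega_perm[OF I] inversions_inject[OF std] by metis
  also have "\<dots> \<longleftrightarrow> (\<forall>(i, j)\<in>position_pairs ?n. w ! (i - 1) > w ! (j - 1) \<longleftrightarrow> {i..<j} \<inter> ?D \<noteq> {})"
    unfolding True[symmetric] inversions_Std some_in_def by blast
  \<comment> \<open>Passing from positions counted from 1 to indices counted from 0 turns
    \<open>{i..<j}\<close> into \<open>{Suc i..j}\<close>.\<close>
  also have "\<dots> \<longleftrightarrow> (\<forall>i j. i < j \<longrightarrow> j < ?n \<longrightarrow> (w ! i > w ! j \<longleftrightarrow> {Suc i..j} \<inter> ?D \<noteq> {}))"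
    (is "?L \<longleftrightarrow> ?R")
  proof
    assume L: ?L
    show ?R
    proof (intro allI impI)
      fix i j assume "i < j" "j < ?n"
      then have "(Suc i, Suc j) \<in> position_pairs ?n" by (simp add: position_pairs_def)
      from bspec[OF L this] show "w ! i > w ! j \<longleftrightarrow> {Suc i..j} \<inter> ?D \<noteq> {}"
        by (simp add: atLeastLessThanSuc_atLeastAtMost)
    qed
  next
    assume R: ?R
    show ?L
    proof clarify
      fix i j assume "(i, j) \<in> position_pairs ?n"
      then have "i - 1 < j - 1" "j - 1 < ?n" "Suc (i - 1) = i" "Suc (j - 1) = j"
        by (auto simp: position_pairs_def)
      with R show "w ! (i - 1) > w ! (j - 1) \<longleftrightarrow> {i..<j} \<inter> ?D \<noteq> {}"
        by (metis atLeastLessThanSuc_atLeastAtMost)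
    qed
  qed
  also have "\<dots> \<longleftrightarrow> (\<forall>u\<in>set (blocks I w). sorted u) \<and>
      successively (\<lambda>u v. hd u > last v) (blocks I w)"
    unfolding descent_free_iff_sorted_blocks[OF I True]
    using separated_iff_successively[OF Nil_notin_blocks[OF I True]] by blast
  finally show ?thesis using True by (simp add: G_series_def)
qed (simp add: G_series_def)

lemma Std_less_iff:
  assumes "i \<in> {1..length w}" "j \<in> {1..length w}" "i < j"
  shows "Std w i > Std w j \<longleftrightarrow> w ! (i - 1) > w ! (j - 1)"
proof -
  have "(i, j) \<in> inversions (length w) (Std w) \<longleftrightarrow> w ! (i - 1) > w ! (j - 1)"
    using assms by (simp add: inversions_Std position_pairs_def)
  then show ?thesis using assms by (simp add: inversions_def position_pairs_def)
qed

text \<open>Adjacent values of \<open>Std w \<circ> omega_perm I\<close> compare letters of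
  \<open>w\<close> in the order in which \<open>omega_perm I\<close> visits them. At a descent of
  \<open>omega_perm I\<close> the second letter lies to the left of the first in \<open>w\<close>,
  otherwise to its right. Either way a tie falls on the desired side, so the inequalities become
  weak.\<close>

lemma descent_set_Std_omega_perm_iff:
  fixes w :: "'a::linorder list"
  assumes I: "I \<in> lists {1..}" and w: "length w = sum_list I"
  shows "descent_set (sum_list I) (Std w \<circ> omega_perm I) = descents_of I \<longleftrightarrow>
    (\<forall>u\<in>set (blocks (rev I) w). sorted u) \<and>
    successively (\<lambda>u v. hd u \<le> last v) (blocks (rev I) w)"
proof -
  let ?n = "sum_list I" and ?D = "descents_of I" and ?\<omega> = "omega_perm I"
  define y where "y = map (\<lambda>p. w ! (?\<omega> (Suc p) - 1)) [0..<?n]"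
  have y: "length y = ?n" by (simp add: y_def)
  have D: "?D \<subseteq> {1..<?n}" using descents_of_subset[OF I] .
  have step: "(Suc i \<in> descent_set ?n (Std w \<circ> ?\<omega>) \<longleftrightarrow> Suc i \<in> ?D) \<longleftrightarrow>
      (if Suc i \<in> ?D then y ! Suc i \<le> y ! i else y ! i \<le> y ! Suc i)" if i: "Suc i < ?n" for i
  proof -
    let ?p = "?\<omega> (Suc i)" and ?q = "?\<omega> (Suc (Suc i))"
    have range: "?p \<in> {1..length w}" "?q \<in> {1..length w}"
      using i permutes_in_image[OF omega_perm(1)[OF I]] by (auto simp: w)
    have "?p \<noteq> ?q"
      using permutes_inj[OF omega_perm(1)[OF I]] by (metis injD n_not_Suc_n)
    then have neq: "Std w ?p \<noteq> Std w ?q"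
      using permutes_inj[OF Std_permutes[of w]] by (metis injD)
    have "?p > ?q \<longleftrightarrow> (Suc i, Suc (Suc i)) \<in> inversions ?n ?\<omega>"
      using i by (simp add: inversions_def position_pairs_def)
    also have "\<dots> \<longleftrightarrow> Suc i \<in> ?D"
      using i by (simp add: omega_perm(2)[OF I] some_in_def position_pairs_def)
    finally have order: "?p > ?q \<longleftrightarrow> Suc i \<in> ?D" .
    have nth: "y ! i = w ! (?p - 1)" "y ! Suc i = w ! (?q - 1)"
      using i by (simp_all add: y_def)
    have des: "Suc i \<in> descent_set ?n (Std w \<circ> ?\<omega>) \<longleftrightarrow> Std w ?p > Std w ?q"
      using i by (simp add: descent_set_def)
    show ?thesis
    proof (cases "Suc i \<in> ?D")
      case True
      then have "?q < ?p" using order by simp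
      from Std_less_iff[OF range(2,1) this] show ?thesis
        using True des neq nth by auto
    next
      case False
      then have "?p < ?q" using order \<open>?p \<noteq> ?q\<close> by simp
      from Std_less_iff[OF range this] show ?thesis
        using False des neq nth by auto
    qed
  qed
  have "descent_set ?n (Std w \<circ> ?\<omega>) = ?D \<longleftrightarrow>
      (\<forall>i. Suc i < ?n \<longrightarrow> (Suc i \<in> descent_set ?n (Std w \<circ> ?\<omega>) \<longleftrightarrow> Suc i \<in> ?D))" (is "?L \<longleftrightarrow> ?R")
  proof
    assume R: ?R
    have sub: "descent_set ?n (Std w \<circ> ?\<omega>) \<subseteq> {1..<?n}" by (auto simp: descent_set_def)
    show ?L
    proof (rule Set.set_eqI)
      fix i
      show "i \<in> descent_set ?n (Std w \<circ> ?\<omega>) \<longleftrightarrow> i \<in> ?D"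
      proof (cases "i \<in> {1..<?n}")
        case True
        then show ?thesis using R by (cases i) auto
      qed (use sub D in blast)
    qed
  qed simp
  also have "\<dots> \<longleftrightarrow> (\<forall>u\<in>set (blocks I y). sorted u) \<and> successively (\<lambda>u v. hd v \<le> last u) (blocks I y)"
    unfolding adjacent_pattern_iff[OF I y, symmetric] using step by blast
  \<comment> \<open>A list of blocks is recovered from its concatenation and its lengths. Reversing
    it turns \<open>hd v \<le> last u\<close> into \<open>hd u \<le> last v\<close>.\<close>
  also have "blocks I y = rev (blocks (rev I) w)"
  proof -
    have "map length (rev (blocks (rev I) w)) = I"
      using map_length_blocks[of w "rev I"] w by (simp add: rev_map[symmetric])
    moreover have "y = concat (rev (blocks (rev I) w))"
      unfolding y_def using map_omega_perm[OF I w] .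
    ultimately show ?thesis using blocks_concat by metis
  qed
  finally show ?thesis by (simp only: successively_rev set_rev)
qed

lemma S_series_diam:
  fixes w :: "'a::linorder list"
  assumes I: "I \<in> lists {1..}"
  shows "S_series (sum_list I) (diam I) w =
    (if length w = sum_list I \<and> (\<forall>u\<in>set (blocks (rev I) w). sorted u) \<and>
        successively (\<lambda>u v. hd u \<le> last v) (blocks (rev I) w) then 1 else 0)"
proof (cases "length w = sum_list I")
  case True
  let ?n = "sum_list I"
  have std: "Std w permutes {1..?n}" using Std_permutes[of w] True by simp
  have "finite {\<tau>. \<tau> permutes {1..?n} \<and> left_weak_le ?n \<tau> (diam I)}"
    by (rule finite_subset[OF _ finite_permutations[of "{1..?n}"]]) auto
  \<comment> \<open>Only the summand at \<open>\<tau> = Std w\<close> can be nonzero, so the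
    coefficient just tests whether \<open>Std w\<close> lies below the diameter.\<close>
  then have "S_series ?n (diam I) w = (if left_weak_le ?n (Std w) (diam I) then 1 else 0)"
    using std True by (simp add: S_series_def G_series_def sum.delta)
  then show ?thesis
    unfolding left_weak_le_diam_iff[OF I std] descent_set_Std_omega_perm_iff[OF I True]
    using True by simp
qed (simp add: S_series_def G_series_def)

section \<open>Chains of blocks\<close>

text \<open>The weight \<open>c\<close> per factor is \<open>- 1\<close> for the signed series and
  \<open>1\<close> for its inverse.\<close>

definition chain_series ::
    "'a list set \<Rightarrow> ('a list \<Rightarrow> 'a list \<Rightarrow> bool) \<Rightarrow> rat \<Rightarrow> 'a list \<Rightarrow> rat" where
  "chain_series X R c w =
    (\<Sum>us | us \<in> lists X \<and> concat us = w \<and> successively R us. c ^ length us)"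

text \<open>Nonempty factors bound their number by the length of \<open>w\<close>, and each is a
  bounded word over the letters of \<open>w\<close>.\<close>

lemma finite_factorizations:
  assumes "[] \<notin> X"
  shows "finite {us \<in> lists X. concat us = w}"
proof (rule finite_subset)
  have "us \<in> {us. set us \<subseteq> {u. set u \<subseteq> set w \<and> length u \<le> length w} \<and> length us \<le> length w}"
    if us: "us \<in> lists X" "concat us = w" for us
  proof -
    have "length us \<le> length (concat us)"
      using us(1)
    proof (induction us)
      case (Cons u us)
      then show ?case using assms by (cases u) auto
    qed simp
    moreover have "length u \<le> length (concat us)" if "u \<in> set us" for u
      using that by (induction us) auto
    moreover have "set u \<subseteq> set (concat us)" if "u \<in> set us" for u
      using that by auto
    ultimately show ?thesis using us(2) by blast
  qed
  then show "{us \<in> lists X. concat us = w} \<subseteq>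
      {us. set us \<subseteq> {u. set u \<subseteq> set w \<and> length u \<le> length w} \<and> length us \<le> length w}" by blast
  show "finite {us. set us \<subseteq> {u. set u \<subseteq> set w \<and> length u \<le> length w} \<and> length us \<le> length w}"
    by (intro finite_lists_length_le) simp
qed

lemma sum_cut_points:
  fixes c :: rat
  shows "(\<Sum>m\<le>length xs. if successively R (take m xs) \<and> successively (\<lambda>x y. \<not> R x y) (drop m xs)
      then c ^ m * (- c) ^ (length xs - m) else 0) = (if xs = [] then 1 else 0)"
    (is "?T xs = _")
proof (induction xs)
  case (Cons x xs)
  let ?f = "\<lambda>xs m. if successively R (take m xs) \<and> successively (\<lambda>x y. \<not> R x y) (drop m xs)
      then c ^ m * (- c) ^ (length xs - m) else 0"
  have shift: "?T (x # xs) = ?f (x # xs) 0 + (\<Sum>m\<le>length xs. ?f (x # xs) (Suc m))"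
    by (simp only: length_Cons sum.atMost_Suc_shift)
  show ?case
  proof (cases xs)
    case Nil
    then show ?thesis by simp
  next
    case (Cons y zs)
    show ?thesis
    proof (cases "R x y")
      case True
      \<comment> \<open>With \<open>R x y\<close> no cut can precede \<open>x\<close>; the other
        cuts are those of \<open>xs\<close>, weighted by \<open>c\<close>, and sum to 0 by
        induction.\<close>
      have "?f (x # xs) (Suc m) = c * ?f xs m" for m
        using True Cons by (cases m) auto
      then have "(\<Sum>m\<le>length xs. ?f (x # xs) (Suc m)) = c * ?T xs"
        by (simp only: sum_distrib_left)
      moreover have "?f (x # xs) 0 = 0" using True Cons by simp
      ultimately have "?T (x # xs) = c * ?T xs" unfolding shift by simp
      then show ?thesis using Cons.IH Cons by simp
    next
      case False
      \<comment> \<open>Without \<open>R x y\<close> only the cuts just before and just after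
        \<open>x\<close> can remain. They are admissible together, and their weights cancel.\<close>
      have "?f (x # xs) (Suc (Suc m)) = 0" for m
        using False Cons by simp
      then have "(\<Sum>m\<le>length xs. ?f (x # xs) (Suc m)) = ?f (x # xs) (Suc 0)"
        using Cons by (simp only: length_Cons sum.atMost_Suc_shift) simp
      then have "?T (x # xs) = ?f (x # xs) 0 + ?f (x # xs) (Suc 0)" unfolding shift by simp
      also have "\<dots> = 0" using False Cons by simp
      finally show ?thesis by simp
    qed
  qed
qed simp

text \<open>A chain for a prefix of \<open>w\<close> and one for the rest form a single
  factorization of \<open>w\<close> with a marked cut. Summing over cuts first leaves only the empty
  factorization, which exists only for the empty word.\<close>

lemma chain_series_mult:
  assumes X: "[] \<notin> X"
  shows "chain_series X R c \<otimes>\<^bsub>NCPS\<^esub> chain_series X (\<lambda>u v. \<not> R u v) (- c) = \<one>\<^bsub>NCPS\<^esub>"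
proof
  fix w :: "'a list"
  let ?S = "\<lambda>u v. \<not> R u v"
  let ?A = "\<lambda>R w. {us. us \<in> lists X \<and> concat us = w \<and> successively R us}"
  let ?F = "{xs \<in> lists X. concat xs = w}"
  let ?M = "\<lambda>xs. {m \<in> {..length xs}. successively R (take m xs) \<and> successively ?S (drop m xs)}"
  have fin: "finite (?A R w)" for R w
    by (rule finite_subset[OF _ finite_factorizations[OF X, of w]]) auto
  have "(chain_series X R c \<otimes>\<^bsub>NCPS\<^esub> chain_series X ?S (- c)) w =
      (\<Sum>k\<le>length w. \<Sum>us\<in>?A R (take k w). \<Sum>vs\<in>?A ?S (drop k w). c ^ length us * (- c) ^ length vs)"
    by (simp add: NCPS_def chain_series_def sum_product)
  also have "\<dots> = (\<Sum>k\<le>length w. \<Sum>(us, vs)\<in>?A R (take k w) \<times> ?A ?S (drop k w).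
      c ^ length us * (- c) ^ length vs)"
    by (simp add: sum.cartesian_product)
  also have "\<dots> = (\<Sum>(k, us, vs)\<in>Sigma {..length w} (\<lambda>k. ?A R (take k w) \<times> ?A ?S (drop k w)).
      c ^ length us * (- c) ^ length vs)"
    using fin by (subst sum.Sigma) (auto simp: case_prod_unfold)
  \<comment> \<open>The split position \<open>k\<close> is forced by the factors before the cut, so
    triples \<open>(k, us, vs)\<close> match factorizations with a cut.\<close>
  also have "\<dots> = (\<Sum>(xs, m)\<in>Sigma ?F ?M. c ^ m * (- c) ^ (length xs - m))"
  proof (rule sum.reindex_bij_witness
      [where i = "\<lambda>(xs, m). (length (concat (take m xs)), take m xs, drop m xs)"
        and j = "\<lambda>(k, us, vs). (us @ vs, length us)"], goal_cases)
    case (4 b)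
    obtain xs m where b: "b = (xs, m)" by (cases b)
    have w: "w = concat (take m xs) @ concat (drop m xs)" "xs \<in> lists X"
      using 4 b by (auto simp flip: concat_append)
    have "set (take m xs) \<subseteq> set xs" "set (drop m xs) \<subseteq> set xs"
      by (auto dest: in_set_takeD in_set_dropD)
    then have "take m xs \<in> lists X" "drop m xs \<in> lists X" using w(2) by auto
    then show ?case using 4 b w(1) by auto
  qed auto
  also have "\<dots> = (\<Sum>xs\<in>?F. \<Sum>m\<in>?M xs. c ^ m * (- c) ^ (length xs - m))"
    by (rule sum.Sigma[symmetric]) (auto simp: finite_factorizations[OF X])
  also have "\<dots> = (\<Sum>xs\<in>?F. if xs = [] then 1 else 0)"
    by (rule sum.cong[OF refl])
      (simp only: sum_cut_points[symmetric, where c = c and R = R] sum.inter_filter[OF finite_atMost])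
  also have "\<dots> = \<one>\<^bsub>NCPS\<^esub> w"
    using finite_factorizations[OF X, of w] by (auto simp: sum.delta NCPS_def)
  finally show "(chain_series X R c \<otimes>\<^bsub>NCPS\<^esub> chain_series X ?S (- c)) w = \<one>\<^bsub>NCPS\<^esub> w" .
qed

section \<open>From sums over compositions to sums over chains\<close>

lemma series_sum_eq:
  assumes "\<And>I. I \<in> C \<Longrightarrow> F I w = (if P I then h I else 0)" "\<And>I. h I \<noteq> 0"
  shows "series_sum C F w = (\<Sum>I | I \<in> C \<and> P I. h I)"
proof -
  have "F I w \<noteq> 0 \<longleftrightarrow> P I" if "I \<in> C" for I
    using assms(1)[OF that] assms(2)[of I] by simp
  then have "{I. I \<in> C \<and> F I w \<noteq> 0} = {I. I \<in> C \<and> P I}"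
    by blast
  then show ?thesis
    unfolding series_sum_def using assms(1) by (intro sum.cong) auto
qed

text \<open>A factorization of a fixed word is determined by the lengths of its factors, so cutting
  along a composition and recording lengths are mutually inverse.\<close>

lemma chain_series_eq_sum_compositions:
  "chain_series {u. sorted u \<and> length u \<in> E} R c w =
    (\<Sum>I | I \<in> lists E \<and> length w = sum_list I \<and> (\<forall>u\<in>set (blocks I w). sorted u) \<and>
      successively R (blocks I w). c ^ length I)"
  unfolding chain_series_def
proof (rule sum.reindex_bij_witness[where i = "\<lambda>I. blocks I w" and j = "map length"], goal_cases)
  case (2 us)
  then show ?case
    using blocks_concat[of us] by (auto simp: length_concat in_lists_conv_set)
next
  case (4 I)
  then have "map length (blocks I w) = I" using map_length_blocks by blast
  then have "\<forall>u\<in>set (blocks I w). length u \<in> E"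
    using 4 by (metis (mono_tags, lifting) imageI in_lists_conv_set mem_Collect_eq set_map)
  then show ?case using 4 concat_blocks[of w I] by auto
qed (use blocks_concat map_length_blocks in \<open>auto simp: length_blocks\<close>)

theorem theorem3p1:
  fixes E :: "nat set"
  assumes "E \<subseteq> {1..}"
  shows "series_sum (lists E) (\<lambda>I w. (-1) ^ length I * G_series (sum_list I) (omega_perm I) w)
           \<in> Units (NCPS :: ('a::linorder list \<Rightarrow> rat) ring) \<and>
         inv\<^bsub>(NCPS :: ('a list \<Rightarrow> rat) ring)\<^esub>
           (series_sum (lists E) (\<lambda>I w. (-1) ^ length I * G_series (sum_list I) (omega_perm I) w))
           = series_sum (lists E) (\<lambda>K. S_series (sum_list K) (diam K))"
proof -
  interpret ring "NCPS :: ('a list \<Rightarrow> rat) ring" by (rule ring_NCPS)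
  let ?A = "series_sum (lists E)
    (\<lambda>I w. (-1) ^ length I * G_series (sum_list I) (omega_perm I) w) :: 'a list \<Rightarrow> rat"
  let ?B = "series_sum (lists E) (\<lambda>K. S_series (sum_list K) (diam K)) :: 'a list \<Rightarrow> rat"
  let ?X = "{u :: 'a list. sorted u \<and> length u \<in> E}"
  let ?R = "\<lambda>u v :: 'a list. hd u > last v"
  let ?S = "\<lambda>u v :: 'a list. \<not> hd u > last v"
  have pos: "I \<in> lists {1..}" if "I \<in> lists E" for I
    using that assms lists_mono by blast
  have A: "?A = chain_series ?X ?R (- 1)"
  proof
    fix w
    show "?A w = chain_series ?X ?R (- 1) w"
      unfolding chain_series_eq_sum_compositions
      by (rule series_sum_eq) (use pos in \<open>simp_all add: G_series_omega_perm\<close>)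
  qed
  have B: "?B = chain_series ?X ?S 1"
  proof
    fix w
    let ?P = "\<lambda>I. length w = sum_list I \<and> (\<forall>u\<in>set (blocks I w). sorted u) \<and> successively ?S (blocks I w)"
    have "?B w = (\<Sum>I | I \<in> lists E \<and> ?P (rev I). 1)"
      by (rule series_sum_eq) (use pos in \<open>simp_all add: S_series_diam not_less\<close>)
    \<comment> \<open>\<open>lists E\<close> is closed under reversal, so the sum over all
      compositions absorbs the mirror image.\<close>
    also have "\<dots> = (\<Sum>I | I \<in> lists E \<and> ?P I. 1)"
      by (rule sum.reindex_bij_witness[where i = rev and j = rev]) auto
    finally show "?B w = chain_series ?X ?S 1 w"
      unfolding chain_series_eq_sum_compositions by simp
  qed
  have X: "[] \<notin> ?X" using assms by auto
  have carrier: "?A \<in> carrier NCPS" "?B \<in> carrier NCPS" by (simp_all add: NCPS_def)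
  have AB: "?A \<otimes>\<^bsub>NCPS\<^esub> ?B = \<one>\<^bsub>NCPS\<^esub>"
    unfolding A B using chain_series_mult[OF X, of ?R "- 1"] by simp
  \<comment> \<open>Complementing the relation and negating the weight are involutions, so the same
    cancellation with the roles exchanged makes the inverse two-sided.\<close>
  have BA: "?B \<otimes>\<^bsub>NCPS\<^esub> ?A = \<one>\<^bsub>NCPS\<^esub>"
    unfolding A B using chain_series_mult[OF X, of ?S 1] by simp
  show ?thesis
    using carrier AB BA inv_unique'[OF carrier AB BA] unfolding Units_def by auto
qed

end
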